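(* Let $L$ be a finite-dimensional perfect diassociative algebra and let $C$ be a cover of $L$. Then $C=C'$ and $M(C)=0$.
   Context: All algebras are over a fixed field $\mathbb{F}$. A diassociative algebra is a vector space $L$ with two bilinear associative products $\dashv,\vdash$ satisfying, for all $x,y,z\in L$: $x\dashv(y\dashv z)=x\dashv(y\vdash z)$, $(x\vdash y)\dashv z=x\vdash(y\dashv z)$, $(x\dashv y)\vdash z=(x\vdash y)\vdash z$. For subalgebras $S,T$ of $L$, $S\lozenge T=S\dashv T+S\vdash T$ (linear span of all products $s\dashv t$ and $s\vdash t$). $L'=L\lozenge L$, and $L$ is perfect if $L=L'$. The center $Z(L)$ is the set of $z\in L$ with $z\dashv x=x\dashv z=z\vdash x=x\vdash z=0$ for all $x\in L$. A defining pair $(K,M)$ of $L$ is a pair of diassociative algebras with $M\subseteq Z(K)\cap K'$ and $K/M\cong L$. It is a maximal defining pair if $\dim K$ is maximal among all defining pairs of $L$; in that case $K$ is called a cover of $L$ and $M$ is called the multiplier of $L$, denoted $M(L)$ (well defined up to isomorphism). It is known that $M(L)\cong (F'\cap R)/(F\lozenge R+R\lozenge F)$ for any free presentation $0\to R\to F\to L\to 0$ of $L$ (i.e. $F$ a free diassociative algebra and $R$ the kernel of the surjection $F\to L$). *)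

theory Defs
  imports Complex_Main "HOL-Library.Function_Algebras"
begin

section \<open>Diassociative algebras\<close>

text \<open>
  The carrier of an algebra is a subspace of an ambient vector space: addition is that of the type
  \<open>'a\<close>, scalar multiplication is the component \<open>scalar\<close>.  Carriers are needed because
  maximality of a defining pair quantifies over algebras of varying dimension.  Every vector space
  (a type with \<^const>\<open>UNIV\<close> as carrier) is an instance.
\<close>

record ('f, 'a) dialgebra =
  carrier :: "'a set"
  scalar :: "'f \<Rightarrow> 'a \<Rightarrow> 'a"
  lprod :: "'a \<Rightarrow> 'a \<Rightarrow> 'a"  ("(_ \<stileturn>\<index> _)" [71, 71] 70)
  rprod :: "'a \<Rightarrow> 'a \<Rightarrow> 'a"  ("(_ \<turnstile>\<index> _)" [71, 71] 70)

definition bilinear_on :: "'a set \<Rightarrow> ('f \<Rightarrow> 'a \<Rightarrow> 'a) \<Rightarrow> ('a \<Rightarrow> 'a \<Rightarrow> 'a::ab_group_add) \<Rightarrow> bool" where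
  "bilinear_on S s p \<longleftrightarrow>
     (\<forall>x\<in>S. \<forall>y\<in>S. \<forall>z\<in>S. p (x + y) z = p x z + p y z \<and> p x (y + z) = p x y + p x z) \<and>
     (\<forall>a. \<forall>x\<in>S. \<forall>y\<in>S. p (s a x) y = s a (p x y) \<and> p x (s a y) = s a (p x y))"

definition closed_under :: "'a set \<Rightarrow> ('a \<Rightarrow> 'a \<Rightarrow> 'a) \<Rightarrow> bool" where
  "closed_under S p \<longleftrightarrow> (\<forall>x\<in>S. \<forall>y\<in>S. p x y \<in> S)"

locale diassociative_algebra =
  fixes A :: "('f::field, 'a::ab_group_add) dialgebra" (structure)
  assumes vector_space: "vector_space (scalar A)"
    and subspace: "module.subspace (scalar A) (carrier A)"
    and lprod_closed: "closed_under (carrier A) (lprod A)"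
    and rprod_closed: "closed_under (carrier A) (rprod A)"
    and lprod_bilinear: "bilinear_on (carrier A) (scalar A) (lprod A)"
    and rprod_bilinear: "bilinear_on (carrier A) (scalar A) (rprod A)"
    and lprod_assoc: "\<lbrakk>x \<in> carrier A; y \<in> carrier A; z \<in> carrier A\<rbrakk>
          \<Longrightarrow> (x \<stileturn> y) \<stileturn> z = x \<stileturn> (y \<stileturn> z)"
    and rprod_assoc: "\<lbrakk>x \<in> carrier A; y \<in> carrier A; z \<in> carrier A\<rbrakk>
          \<Longrightarrow> (x \<turnstile> y) \<turnstile> z = x \<turnstile> (y \<turnstile> z)"
    and left_bar: "\<lbrakk>x \<in> carrier A; y \<in> carrier A; z \<in> carrier A\<rbrakk>
          \<Longrightarrow> x \<stileturn> (y \<stileturn> z) = x \<stileturn> (y \<turnstile> z)"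
    and inner_assoc: "\<lbrakk>x \<in> carrier A; y \<in> carrier A; z \<in> carrier A\<rbrakk>
          \<Longrightarrow> (x \<turnstile> y) \<stileturn> z = x \<turnstile> (y \<stileturn> z)"
    and right_bar: "\<lbrakk>x \<in> carrier A; y \<in> carrier A; z \<in> carrier A\<rbrakk>
          \<Longrightarrow> (x \<stileturn> y) \<turnstile> z = (x \<turnstile> y) \<turnstile> z"

definition subalgebra :: "'a set \<Rightarrow> ('f::field, 'a::ab_group_add) dialgebra \<Rightarrow> bool" where
  "subalgebra S A \<longleftrightarrow> S \<subseteq> carrier A \<and> module.subspace (scalar A) S \<and>
     closed_under S (lprod A) \<and> closed_under S (rprod A)"

definition lozenge_prod :: "('f::field, 'a::ab_group_add) dialgebra \<Rightarrow> 'a set \<Rightarrow> 'a set \<Rightarrow> 'a set" where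
  "lozenge_prod A S T = module.span (scalar A)
     ({s \<stileturn>\<^bsub>A\<^esub> t | s t. s \<in> S \<and> t \<in> T} \<union> {s \<turnstile>\<^bsub>A\<^esub> t | s t. s \<in> S \<and> t \<in> T})"

definition derived :: "('f::field, 'a::ab_group_add) dialgebra \<Rightarrow> 'a set" where
  "derived A = lozenge_prod A (carrier A) (carrier A)"

definition perfect :: "('f::field, 'a::ab_group_add) dialgebra \<Rightarrow> bool" where
  "perfect A \<longleftrightarrow> carrier A = derived A"

definition center :: "('f::field, 'a::ab_group_add) dialgebra \<Rightarrow> 'a set" where
  "center A = {z \<in> carrier A. \<forall>x\<in>carrier A.
     z \<stileturn>\<^bsub>A\<^esub> x = 0 \<and> x \<stileturn>\<^bsub>A\<^esub> z = 0 \<and> z \<turnstile>\<^bsub>A\<^esub> x = 0 \<and> x \<turnstile>\<^bsub>A\<^esub> z = 0}"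

definition finite_dimensional :: "('f::field, 'a::ab_group_add) dialgebra \<Rightarrow> bool" where
  "finite_dimensional A \<longleftrightarrow> (\<exists>B. finite B \<and> module.span (scalar A) B = carrier A)"

definition dimension :: "('f::field, 'a::ab_group_add) dialgebra \<Rightarrow> nat" where
  "dimension A = vector_space.dim (scalar A) (carrier A)"


section \<open>Covers and multipliers\<close>

definition coset :: "'a::ab_group_add set \<Rightarrow> 'a \<Rightarrow> 'a set" where
  "coset M x = (\<lambda>m. x + m) ` M"

text \<open>
  \<open>quotient_iso K M L \<phi>\<close>: the map \<open>\<phi>\<close> is an isomorphism \<open>K/M \<rightarrow> L\<close>, where the elements of \<open>K/M\<close>
  are the cosets \<open>coset M x\<close> and its operations are those induced on representatives.
\<close>

definition quotient_iso ::
  "('f::field, 'k::ab_group_add) dialgebra \<Rightarrow> 'k set \<Rightarrow> ('f, 'a::ab_group_add) dialgebra \<Rightarrow> ('k set \<Rightarrow> 'a) \<Rightarrow> bool" where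
  "quotient_iso K M L \<phi> \<longleftrightarrow>
     bij_betw \<phi> (coset M ` carrier K) (carrier L) \<and>
     (\<forall>x\<in>carrier K. \<forall>y\<in>carrier K.
        \<phi> (coset M (x + y)) = \<phi> (coset M x) + \<phi> (coset M y) \<and>
        \<phi> (coset M (x \<stileturn>\<^bsub>K\<^esub> y)) = \<phi> (coset M x) \<stileturn>\<^bsub>L\<^esub> \<phi> (coset M y) \<and>
        \<phi> (coset M (x \<turnstile>\<^bsub>K\<^esub> y)) = \<phi> (coset M x) \<turnstile>\<^bsub>L\<^esub> \<phi> (coset M y)) \<and>
     (\<forall>a. \<forall>x\<in>carrier K. \<phi> (coset M (scalar K a x)) = scalar L a (\<phi> (coset M x)))"

definition defining_pair ::
  "('f::field, 'a::ab_group_add) dialgebra \<Rightarrow> ('f, 'k::ab_group_add) dialgebra \<Rightarrow> 'k set \<Rightarrow> bool" where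
  "defining_pair L K M \<longleftrightarrow>
     diassociative_algebra K \<and> subalgebra M K \<and> M \<subseteq> center K \<inter> derived K \<and>
     (\<exists>\<phi>. quotient_iso K M L \<phi>)"

text \<open>
  A formula cannot quantify over types, so the competitors in the definition of maximality live in
  one fixed type, \<open>nat \<Rightarrow> 'f\<close>.  For finite-dimensional \<open>L\<close> (the only case in which the notion is
  used here) this is no restriction: by \<open>maximal_defining_pair_universal\<close> below, every
  defining pair of \<open>L\<close>, over whatever type, is finite-dimensional of dimension at most
  \<open>dimension K\<close>.  By \<open>maximal_defining_pair_exists\<close>, maximal pairs exist.
\<close>

definition maximal_defining_pair ::
  "('f::field, 'a::ab_group_add) dialgebra \<Rightarrow> ('f, 'k::ab_group_add) dialgebra \<Rightarrow> 'k set \<Rightarrow> bool" where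
  "maximal_defining_pair L K M \<longleftrightarrow> defining_pair L K M \<and>
     (\<forall>(K' :: ('f, nat \<Rightarrow> 'f) dialgebra) M'. defining_pair L K' M' \<longrightarrow> dimension K' \<le> dimension K)"

definition is_cover ::
  "('f::field, 'a::ab_group_add) dialgebra \<Rightarrow> ('f, 'k::ab_group_add) dialgebra \<Rightarrow> bool" where
  "is_cover L K \<longleftrightarrow> (\<exists>M. maximal_defining_pair L K M)"

text \<open>The multiplier is only determined up to isomorphism, hence a relation.\<close>

definition is_multiplier ::
  "('f::field, 'a::ab_group_add) dialgebra \<Rightarrow> 'k::ab_group_add set \<Rightarrow> bool" where
  "is_multiplier L M \<longleftrightarrow> (\<exists>K :: ('f, 'k) dialgebra. maximal_defining_pair L K M)"


section \<open>Adequacy of the definition of maximality\<close>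

lemma coset_eq_iff:
  assumes "vector_space s" "module.subspace s M"
  shows "coset M x = coset M y \<longleftrightarrow> x - y \<in> M"
proof -
  interpret vector_space s by fact
  note S = assms(2)
  show ?thesis
  proof
    assume "coset M x = coset M y"
    moreover have "x \<in> coset M x"
      using subspace_0[OF S] unfolding coset_def by force
    ultimately show "x - y \<in> M" unfolding coset_def by auto
  next
    assume d: "x - y \<in> M"
    have "x + m \<in> coset M y" if "m \<in> M" for m
      unfolding coset_def using subspace_add[OF S d that]
      by (intro image_eqI[of _ _ "(x - y) + m"]) (auto simp: algebra_simps)
    moreover have "y + m \<in> coset M x" if "m \<in> M" for m
      unfolding coset_def using subspace_diff[OF S that d]
      by (intro image_eqI[of _ _ "m - (x - y)"]) (auto simp: algebra_simps)
    ultimately show "coset M x = coset M y" unfolding coset_def by auto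
  qed
qed

lemma bilinear_span_subset:
  assumes V: "vector_space s" and S: "module.subspace s S" and b: "bilinear_on S s p"
    and G: "G \<subseteq> S" and x: "x \<in> module.span s G" and y: "y \<in> module.span s G"
  shows "p x y \<in> module.span s {p g h | g h. g \<in> G \<and> h \<in> G}"
proof -
  interpret vector_space s by fact
  let ?P = "{p g h | g h. g \<in> G \<and> h \<in> G}"
  have sub: "span G \<subseteq> S" using G S span_minimal by blast
  have z1: "p 0 z = 0" if "z \<in> S" for z
  proof -
    have "p (s 0 0) z = s 0 (p 0 z)" using b that subspace_0[OF S] unfolding bilinear_on_def by blast
    then show ?thesis by simp
  qed
  have z2: "p z 0 = 0" if "z \<in> S" for z
  proof -
    have "p z (s 0 0) = s 0 (p z 0)" using b that subspace_0[OF S] unfolding bilinear_on_def by blast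
    then show ?thesis by simp
  qed
  note bD = b[unfolded bilinear_on_def]
  have yS: "y \<in> S" using y sub by blast
  have 1: "y \<in> S \<and> p g y \<in> span ?P" if g: "g \<in> G" for g
    using y
  proof (induction rule: span_induct_alt)
    case base
    then show ?case using z2[of g] g G subspace_0[OF S] span_zero by auto
  next
    case (step c x y)
    have m: "s c x \<in> S" "y \<in> S" "g \<in> S" "x \<in> S"
      using step g G by (auto intro: subspace_scale[OF S])
    have "p g (s c x + y) = s c (p g x) + p g y"
      using m bD by simp
    moreover have "p g x \<in> span ?P" using g step by (intro span_base) auto
    ultimately show ?case using step m by (simp add: span_add span_scale subspace_add[OF S])
  qed
  have "x \<in> S \<and> p x y \<in> span ?P"
    using x
  proof (induction rule: span_induct_alt)
    case base
    then show ?case using z1[OF yS] subspace_0[OF S] span_zero by auto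
  next
    case (step c x x')
    have m: "s c x \<in> S" "x' \<in> S" "x \<in> S"
      using step G by (auto intro: subspace_scale[OF S])
    have "p (s c x + x') y = s c (p x y) + p x' y"
      using m yS bD by simp
    then show ?case using step 1 m by (simp add: span_add span_scale subspace_add[OF S])
  qed
  then show ?thesis by simp
qed

lemma defining_pair_spanning_set:
  fixes L :: "('f::field, 'a::ab_group_add) dialgebra" and K :: "('f, 'k::ab_group_add) dialgebra"
  assumes D: "defining_pair L K M" and VL: "vector_space (scalar L)"
    and B: "finite B" "module.span (scalar L) B = carrier L"
  obtains W where "finite W" "card W \<le> card B + 2 * (card B * card B)"
    "module.span (scalar K) W = carrier K"
proof -
  interpret K: diassociative_algebra K using D by (simp add: defining_pair_def)
  interpret V: vector_space "scalar K" by (rule K.vector_space)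
  interpret VL: vector_space "scalar L" by (rule VL)
  note S = K.subspace
  have M: "M \<subseteq> center K" "M \<subseteq> derived K" "V.subspace M" "M \<subseteq> carrier K"
    using D by (auto simp: defining_pair_def subalgebra_def)
  obtain \<phi> where \<phi>: "quotient_iso K M L \<phi>" using D by (auto simp: defining_pair_def)
  define \<pi> where "\<pi> x = \<phi> (coset M x)" for x
  have bij: "bij_betw \<phi> (coset M ` carrier K) (carrier L)" using \<phi> by (simp add: quotient_iso_def)
  have add: "\<pi> (x + y) = \<pi> x + \<pi> y" if "x \<in> carrier K" "y \<in> carrier K" for x y
    using \<phi> that by (simp add: quotient_iso_def \<pi>_def)
  have sc: "\<pi> (scalar K a x) = scalar L a (\<pi> x)" if "x \<in> carrier K" for x a
    using \<phi> that by (simp add: quotient_iso_def \<pi>_def)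
  have surj: "\<pi> ` carrier K = carrier L"
    using bij by (auto simp: \<pi>_def bij_betw_def image_image)
  have ker: "x - y \<in> M" if "x \<in> carrier K" "y \<in> carrier K" "\<pi> x = \<pi> y" for x y
  proof -
    have "coset M x = coset M y"
      using bij that unfolding bij_betw_def \<pi>_def inj_on_def by blast
    then show ?thesis using coset_eq_iff[OF K.vector_space M(3)] by blast
  qed
  have Bc: "B \<subseteq> carrier L" using B(2) VL.span_superset by auto
  then have "\<forall>b\<in>B. \<exists>g. g \<in> carrier K \<and> \<pi> g = b" by (metis surj imageE subsetD)
  then obtain g where g: "\<And>b. b \<in> B \<Longrightarrow> g b \<in> carrier K \<and> \<pi> (g b) = b" by metis
  define G where "G = g ` B"
  have G: "G \<subseteq> carrier K" "finite G" "card G \<le> card B"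
    using g B by (auto simp: G_def card_image_le)
  have spG: "V.span G \<subseteq> carrier K" using G S V.span_minimal by blast
  have pre: "\<exists>u \<in> V.span G. \<pi> u = y" if "y \<in> VL.span B" for y
    using that
  proof (induction rule: VL.span_induct_alt)
    case base
    have "\<pi> (scalar K 0 0) = scalar L 0 (\<pi> 0)" by (rule sc) (rule V.subspace_0[OF S])
    then show ?case using V.span_zero by (intro bexI[of _ 0]) auto
  next
    case (step c x y)
    then obtain u where u: "u \<in> V.span G" "\<pi> u = y" by blast
    have gx: "g x \<in> V.span G" using step by (auto simp: G_def intro: V.span_base)
    show ?case
    proof (intro bexI[of _ "scalar K c (g x) + u"])
      show "\<pi> (scalar K c (g x) + u) = scalar L c x + y"
        using u g[of x] step spG by (auto simp: add sc V.subspace_scale[OF S] subsetD)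
      show "scalar K c (g x) + u \<in> V.span G" using gx u by (simp add: V.span_add V.span_scale)
    qed
  qed
  have dec: "\<exists>u\<in>V.span G. x - u \<in> M" if x: "x \<in> carrier K" for x
  proof -
    have "\<pi> x \<in> VL.span B" using x surj B by auto
    then obtain u where "u \<in> V.span G" "\<pi> u = \<pi> x" using pre by blast
    then show ?thesis using ker[of x u] x spG by auto
  qed
  define P where "P p = {p g h | g h. g \<in> G \<and> h \<in> G}" for p :: "'k \<Rightarrow> 'k \<Rightarrow> 'k"
  have Pim: "P p = (\<lambda>(g, h). p g h) ` (G \<times> G)" for p by (auto simp: P_def)
  have Pfin: "finite (P p)" and Pcard: "card (P p) \<le> card B * card B" for p
  proof -
    show "finite (P p)" unfolding Pim using G by auto
    have "card (P p) \<le> card (G \<times> G)" unfolding Pim using G by (intro card_image_le) auto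
    also have "\<dots> = card G * card G" by (simp add: card_cartesian_product)
    also have "\<dots> \<le> card B * card B" using G by (intro mult_mono) auto
    finally show "card (P p) \<le> card B * card B" .
  qed
  have prod: "p x y \<in> V.span (P p)"
    if b: "bilinear_on (carrier K) (scalar K) p" and x: "x \<in> carrier K" and y: "y \<in> carrier K"
      and zr: "\<And>z w. z \<in> M \<Longrightarrow> w \<in> carrier K \<Longrightarrow> p z w = 0 \<and> p w z = 0" for p x y
  proof -
    obtain u v where u: "u \<in> V.span G" "x - u \<in> M" and v: "v \<in> V.span G" "y - v \<in> M"
      using dec x y by metis
    have c: "u \<in> carrier K" "v \<in> carrier K" "x - u \<in> carrier K" "y - v \<in> carrier K"
      using u v spG M by auto
    have "p ((x - u) + u) y = p (x - u) y + p u y"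
      using b c y unfolding bilinear_on_def by blast
    moreover have "p u ((y - v) + v) = p u (y - v) + p u v"
      using b c unfolding bilinear_on_def by blast
    moreover have "p (x - u) y = 0" "p u (y - v) = 0"
      using zr u v c y by blast+
    ultimately have "p x y = p u v" by simp
    also have "\<dots> \<in> V.span (P p)"
      unfolding P_def by (rule bilinear_span_subset[OF K.vector_space S b G(1) u(1) v(1)])
    finally show ?thesis .
  qed
  define Q where "Q = P (lprod K) \<union> P (rprod K)"
  have der: "derived K \<subseteq> V.span Q"
    unfolding derived_def lozenge_prod_def
  proof (intro V.span_minimal V.subspace_span subsetI)
    fix z assume "z \<in> {s \<stileturn>\<^bsub>K\<^esub> t |s t. s \<in> carrier K \<and> t \<in> carrier K} \<union>
                {s \<turnstile>\<^bsub>K\<^esub> t |s t. s \<in> carrier K \<and> t \<in> carrier K}"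
    then obtain s t where st: "s \<in> carrier K" "t \<in> carrier K" "z = s \<stileturn>\<^bsub>K\<^esub> t \<or> z = s \<turnstile>\<^bsub>K\<^esub> t"
      by blast
    have "s \<stileturn>\<^bsub>K\<^esub> t \<in> V.span (P (lprod K))"
      using st M by (intro prod K.lprod_bilinear) (auto simp: center_def subset_iff)
    moreover have "s \<turnstile>\<^bsub>K\<^esub> t \<in> V.span (P (rprod K))"
      using st M by (intro prod K.rprod_bilinear) (auto simp: center_def subset_iff)
    ultimately show "z \<in> V.span Q"
      using st(3) V.span_mono[of "P (lprod K)" Q] V.span_mono[of "P (rprod K)" Q]
      unfolding Q_def by blast
  qed
  define W where "W = G \<union> Q"
  have "finite W" using G Pfin by (auto simp: W_def Q_def)
  moreover have "card W \<le> card B + 2 * (card B * card B)"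
  proof -
    have "card Q \<le> card (P (lprod K)) + card (P (rprod K))" unfolding Q_def by (rule card_Un_le)
    also have "\<dots> \<le> 2 * (card B * card B)" using Pcard[of "lprod K"] Pcard[of "rprod K"] by linarith
    finally have "card Q \<le> 2 * (card B * card B)" .
    then show ?thesis using card_Un_le[of G Q] G unfolding W_def by linarith
  qed
  moreover have "V.span W = carrier K"
  proof
    have "Q \<subseteq> carrier K"
      using G(1) K.lprod_closed K.rprod_closed
      unfolding Q_def P_def closed_under_def by blast
    then show "V.span W \<subseteq> carrier K" using G S unfolding W_def by (intro V.span_minimal) auto
    show "carrier K \<subseteq> V.span W"
    proof
      fix x assume "x \<in> carrier K"
      then obtain u where u: "u \<in> V.span G" "x - u \<in> M" using dec by blast
      have "x - u \<in> V.span W" using u M der V.span_mono[of Q W] unfolding W_def by blast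
      moreover have "u \<in> V.span W" using u V.span_mono[of G W] unfolding W_def by blast
      ultimately have "(x - u) + u \<in> V.span W" by (rule V.span_add)
      then show "x \<in> V.span W" by simp
    qed
  qed
  ultimately show ?thesis by (rule that)
qed

lemma finite_dimensional_transport:
  fixes K :: "('f::field, 'k::ab_group_add) dialgebra"
  assumes K: "diassociative_algebra K" and fin: "finite_dimensional K"
  obtains K' :: "('f, nat \<Rightarrow> 'f) dialgebra" and T where
    "vector_space (scalar K')" "module.subspace (scalar K') (carrier K')"
    "bij_betw T (carrier K') (carrier K)"
    "Vector_Spaces.linear (scalar K') (scalar K) T"
    "\<And>x y. \<lbrakk>x \<in> carrier K'; y \<in> carrier K'\<rbrakk> \<Longrightarrow>
       x \<stileturn>\<^bsub>K'\<^esub> y \<in> carrier K' \<and> x \<turnstile>\<^bsub>K'\<^esub> y \<in> carrier K' \<and>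
       T (x \<stileturn>\<^bsub>K'\<^esub> y) = T x \<stileturn>\<^bsub>K\<^esub> T y \<and> T (x \<turnstile>\<^bsub>K'\<^esub> y) = T x \<turnstile>\<^bsub>K\<^esub> T y"
    "dimension K' = dimension K"
proof -
  interpret K: diassociative_algebra K by (rule K)
  interpret V: vector_space "scalar K" by (rule K.vector_space)
  define s :: "'f \<Rightarrow> (nat \<Rightarrow> 'f) \<Rightarrow> nat \<Rightarrow> 'f" where "s a v = (\<lambda>i. a * v i)" for a v
  interpret U: vector_space s
    by unfold_locales (auto simp: s_def fun_eq_iff algebra_simps)
  obtain B0 where B0: "finite B0" "V.span B0 = carrier K"
    using fin by (auto simp: finite_dimensional_def)
  obtain B where B: "B \<subseteq> B0" "V.independent B" "B0 \<subseteq> V.span B"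
    using V.maximal_independent_subset[of B0] by metis
  have finB: "finite B" using B B0 finite_subset by blast
  have spB: "V.span B = carrier K"
    using B B0 by (metis V.span_mono V.span_span subset_antisym)
  obtain n and b :: "nat \<Rightarrow> 'k" where b: "bij_betw b {..<n} B"
    using finB ex_bij_betw_nat_finite[of B] by (auto simp: atLeast0LessThan)
  define T where "T v = (\<Sum>i<n. scalar K (v i) (b i))" for v
  have Tlin: "Vector_Spaces.linear s (scalar K) T"
    by unfold_locales
       (auto simp: T_def s_def V.scale_left_distrib sum.distrib V.scale_sum_right V.scale_scale)
  interpret T: Vector_Spaces.linear s "scalar K" T by (rule Tlin)
  define S where "S = {v :: nat \<Rightarrow> 'f. \<forall>i\<ge>n. v i = 0}"
  have subS: "U.subspace S" by (auto simp: U.subspace_def S_def s_def)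
  have inj: "inj_on T S"
  proof (rule inj_onI)
    fix v w assume vw: "v \<in> S" "w \<in> S" "T v = T w"
    have "(\<Sum>i<n. scalar K ((v - w) i) (b i)) = 0"
      using vw T.diff[of v w] by (simp add: T_def)
    moreover have "(\<Sum>i<n. scalar K ((v - w) i) (b i)) =
        (\<Sum>x\<in>B. scalar K ((v - w) (the_inv_into {..<n} b x)) x)"
      by (subst sum.reindex_bij_betw[OF b, symmetric])
        (use b in \<open>auto simp: bij_betw_def the_inv_into_f_f intro!: sum.cong\<close>)
    ultimately have 0: "(\<Sum>x\<in>B. scalar K ((v - w) (the_inv_into {..<n} b x)) x) = 0" by simp
    have "(v - w) i = 0" if "i < n" for i
    proof -
      have "b i \<in> B" using b that by (auto simp: bij_betw_def)
      then have "(v - w) (the_inv_into {..<n} b (b i)) = 0"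
        using V.independentD[OF B(2) finB subset_refl 0] by blast
      then show ?thesis using b that by (simp add: bij_betw_def the_inv_into_f_f)
    qed
    then show "v = w" using vw by (auto simp: S_def fun_eq_iff) (metis not_le)
  qed
  have im: "T ` S = carrier K"
  proof
    have "b i \<in> carrier K" if "i < n" for i
    proof -
      have "b i \<in> B" using b that by (auto simp: bij_betw_def)
      then show ?thesis using V.span_base spB by blast
    qed
    then show "T ` S \<subseteq> carrier K"
      by (auto simp: T_def intro!: V.subspace_sum[OF K.subspace] V.subspace_scale[OF K.subspace])
    show "carrier K \<subseteq> T ` S"
      unfolding spB[symmetric]
    proof (rule V.span_minimal)
      show "V.subspace (T ` S)" using T.subspace_image[OF subS] .
      show "B \<subseteq> T ` S"
      proof
        fix x assume "x \<in> B"
        then obtain j where j: "j < n" "b j = x" using b by (auto simp: bij_betw_def)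
        have "T (\<lambda>i. if i = j then 1 else 0) = (\<Sum>i<n. if i = j then b i else 0)"
          unfolding T_def by (intro sum.cong) auto
        also have "\<dots> = x" using j by simp
        finally show "x \<in> T ` S" using j by (intro image_eqI) (auto simp: S_def)
      qed
    qed
  qed
  define I where "I = the_inv_into S T"
  have I: "I y \<in> S" "T (I y) = y" if "y \<in> carrier K" for y
    using that inj im by (auto simp: I_def the_inv_into_into f_the_inv_into_f)
  define K' where "K' = \<lparr>carrier = S, scalar = s, lprod = \<lambda>x y. I (T x \<stileturn>\<^bsub>K\<^esub> T y),
      rprod = \<lambda>x y. I (T x \<turnstile>\<^bsub>K\<^esub> T y)\<rparr>"
  have "dimension K' = dimension K"
  proof -
    obtain E where E: "E \<subseteq> S" "U.independent E" "S \<subseteq> U.span E" "card E = U.dim S"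
      using U.basis_exists[of S] by blast
    have spE: "U.span E = S" using E U.span_minimal[OF E(1) subS] by blast
    interpret p: vector_space_pair s "scalar K" by unfold_locales
    have "V.independent (T ` E)"
      using p.linear_independent_injective_image[OF Tlin E(2)] inj spE by simp
    moreover have "V.span (T ` E) = carrier K" using T.span_image[of E] spE im by simp
    ultimately have "V.dim (carrier K) = card (T ` E)"
      by (metis V.dim_eq_card_independent V.dim_span)
    also have "\<dots> = card E" using inj E(1) by (intro card_image) (auto intro: inj_on_subset)
    finally show ?thesis using E by (simp add: dimension_def K'_def)
  qed
  moreover have "T x \<stileturn>\<^bsub>K\<^esub> T y \<in> carrier K \<and> T x \<turnstile>\<^bsub>K\<^esub> T y \<in> carrier K"
    if "x \<in> S" "y \<in> S" for x y
    using that im K.lprod_closed K.rprod_closed unfolding closed_under_def by blast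
  ultimately show ?thesis
    using U.vector_space_axioms subS inj im Tlin I
    by (intro that[of K' T]) (auto simp: K'_def bij_betw_def)
qed

lemma defining_pair_transport:
  fixes K :: "('f::field, 'k::ab_group_add) dialgebra"
  assumes D: "defining_pair L K M" and fin: "finite_dimensional K"
  obtains K' :: "('f, nat \<Rightarrow> 'f) dialgebra" and M' where
    "defining_pair L K' M'" "dimension K' = dimension K"
proof -
  have K: "diassociative_algebra K" using D by (simp add: defining_pair_def)
  interpret K: diassociative_algebra K by (rule K)
  obtain K' :: "('f, nat \<Rightarrow> 'f) dialgebra" and T where
    V': "vector_space (scalar K')" and S': "module.subspace (scalar K') (carrier K')"
    and bij: "bij_betw T (carrier K') (carrier K)"
    and lin: "Vector_Spaces.linear (scalar K') (scalar K) T"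
    and pr: "\<And>x y. \<lbrakk>x \<in> carrier K'; y \<in> carrier K'\<rbrakk> \<Longrightarrow>
       x \<stileturn>\<^bsub>K'\<^esub> y \<in> carrier K' \<and> x \<turnstile>\<^bsub>K'\<^esub> y \<in> carrier K' \<and>
       T (x \<stileturn>\<^bsub>K'\<^esub> y) = T x \<stileturn>\<^bsub>K\<^esub> T y \<and> T (x \<turnstile>\<^bsub>K'\<^esub> y) = T x \<turnstile>\<^bsub>K\<^esub> T y"
    and dim: "dimension K' = dimension K"
    by (rule finite_dimensional_transport[OF K fin]) blast
  interpret V': vector_space "scalar K'" by (rule V')
  interpret V: vector_space "scalar K" by (rule K.vector_space)
  interpret T: Vector_Spaces.linear "scalar K'" "scalar K" T by (rule lin)
  have inj: "inj_on T (carrier K')" and im: "T ` carrier K' = carrier K"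
    using bij by (auto simp: bij_betw_def)
  have T: "T x \<in> carrier K" if "x \<in> carrier K'" for x using im that by blast
  have cl: "x \<stileturn>\<^bsub>K'\<^esub> y \<in> carrier K'" "x \<turnstile>\<^bsub>K'\<^esub> y \<in> carrier K'"
    "T (x \<stileturn>\<^bsub>K'\<^esub> y) = T x \<stileturn>\<^bsub>K\<^esub> T y" "T (x \<turnstile>\<^bsub>K'\<^esub> y) = T x \<turnstile>\<^bsub>K\<^esub> T y"
    if "x \<in> carrier K'" "y \<in> carrier K'" for x y
    using pr[OF that] by auto
  note ad = V'.subspace_add[OF S'] V'.subspace_scale[OF S']
  have eqI: "x = y" if "x \<in> carrier K'" "y \<in> carrier K'" "T x = T y" for x y
    using inj that by (meson inj_onD)
  have bl: "bilinear_on (carrier K') (scalar K') (lprod K')"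
    using K.lprod_bilinear unfolding bilinear_on_def
    by (intro conjI ballI allI; intro eqI; simp add: cl ad T T.add T.scale)
  have br: "bilinear_on (carrier K') (scalar K') (rprod K')"
    using K.rprod_bilinear unfolding bilinear_on_def
    by (intro conjI ballI allI; intro eqI; simp add: cl ad T T.add T.scale)
  have K': "diassociative_algebra K'"
  proof (rule diassociative_algebra.intro)
    show "closed_under (carrier K') (lprod K')" "closed_under (carrier K') (rprod K')"
      by (simp_all add: closed_under_def cl)
    fix x y z assume c: "x \<in> carrier K'" "y \<in> carrier K'" "z \<in> carrier K'"
    show "(x \<stileturn>\<^bsub>K'\<^esub> y) \<stileturn>\<^bsub>K'\<^esub> z = x \<stileturn>\<^bsub>K'\<^esub> (y \<stileturn>\<^bsub>K'\<^esub> z)"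
      using c by (intro eqI) (simp_all add: cl T K.lprod_assoc)
    show "(x \<turnstile>\<^bsub>K'\<^esub> y) \<turnstile>\<^bsub>K'\<^esub> z = x \<turnstile>\<^bsub>K'\<^esub> (y \<turnstile>\<^bsub>K'\<^esub> z)"
      using c by (intro eqI) (simp_all add: cl T K.rprod_assoc)
    show "x \<stileturn>\<^bsub>K'\<^esub> (y \<stileturn>\<^bsub>K'\<^esub> z) = x \<stileturn>\<^bsub>K'\<^esub> (y \<turnstile>\<^bsub>K'\<^esub> z)"
      using c by (intro eqI) (simp_all add: cl T K.left_bar)
    show "(x \<turnstile>\<^bsub>K'\<^esub> y) \<stileturn>\<^bsub>K'\<^esub> z = x \<turnstile>\<^bsub>K'\<^esub> (y \<stileturn>\<^bsub>K'\<^esub> z)"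
      using c by (intro eqI) (simp_all add: cl T K.inner_assoc)
    show "(x \<stileturn>\<^bsub>K'\<^esub> y) \<turnstile>\<^bsub>K'\<^esub> z = (x \<turnstile>\<^bsub>K'\<^esub> y) \<turnstile>\<^bsub>K'\<^esub> z"
      using c by (intro eqI) (simp_all add: cl T K.right_bar)
  qed (fact V' S' bl br)+
  define M' where "M' = {v \<in> carrier K'. T v \<in> M}"
  have M: "M \<subseteq> center K" "M \<subseteq> derived K" "V.subspace M" "M \<subseteq> carrier K"
      "closed_under M (lprod K)" "closed_under M (rprod K)"
    using D by (auto simp: defining_pair_def subalgebra_def)
  have sub: "subalgebra M' K'"
    using M S' by (auto simp: subalgebra_def M'_def V'.subspace_def V.subspace_def closed_under_def
        cl T.add T.scale T.zero)
  have cen: "M' \<subseteq> center K'"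
  proof
    fix z assume z: "z \<in> M'"
    have 0: "0 \<in> carrier K'" using V'.subspace_0[OF S'] .
    show "z \<in> center K'"
      using z M(1) by (auto simp: center_def M'_def subset_iff intro!: eqI[OF _ 0] simp: cl T T.zero)
  qed
  have der: "M' \<subseteq> derived K'"
  proof -
    let ?P' = "{s \<stileturn>\<^bsub>K'\<^esub> t |s t. s \<in> carrier K' \<and> t \<in> carrier K'} \<union>
                {s \<turnstile>\<^bsub>K'\<^esub> t |s t. s \<in> carrier K' \<and> t \<in> carrier K'}"
    let ?P = "{s \<stileturn>\<^bsub>K\<^esub> t |s t. s \<in> carrier K \<and> t \<in> carrier K} \<union>
                {s \<turnstile>\<^bsub>K\<^esub> t |s t. s \<in> carrier K \<and> t \<in> carrier K}"
    have P': "?P' \<subseteq> carrier K'" using cl by auto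
    have "?P \<subseteq> T ` ?P'"
    proof
      fix z assume "z \<in> ?P"
      then obtain s t where st: "s \<in> carrier K" "t \<in> carrier K"
        "z = s \<stileturn>\<^bsub>K\<^esub> t \<or> z = s \<turnstile>\<^bsub>K\<^esub> t" by blast
      obtain s' t' where s't': "s' \<in> carrier K'" "t' \<in> carrier K'" "s = T s'" "t = T t'"
        using st im by (metis imageE)
      from st(3) show "z \<in> T ` ?P'"
      proof
        assume "z = s \<stileturn>\<^bsub>K\<^esub> t"
        then have "z = T (s' \<stileturn>\<^bsub>K'\<^esub> t')" using s't' cl by simp
        then show ?thesis using s't' by blast
      next
        assume "z = s \<turnstile>\<^bsub>K\<^esub> t"
        then have "z = T (s' \<turnstile>\<^bsub>K'\<^esub> t')" using s't' cl by simp
        then show ?thesis using s't' by blast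
      qed
    qed
    then have "V.span ?P \<subseteq> T ` V'.span ?P'"
      unfolding T.span_image[symmetric] by (rule V.span_mono)
    then have "derived K \<subseteq> T ` derived K'"
      unfolding derived_def lozenge_prod_def .
    moreover have "derived K' \<subseteq> carrier K'"
      unfolding derived_def lozenge_prod_def using P' S' V'.span_minimal by blast
    ultimately show ?thesis using M(2) eqI unfolding M'_def by blast
  qed
  obtain \<phi> where \<phi>: "quotient_iso K M L \<phi>" using D by (auto simp: defining_pair_def)
  have TM: "T ` M' = M" using im M(4) by (auto simp: M'_def)
  have Tc: "T ` coset M' x = coset M (T x)" for x
  proof -
    have "T ` coset M' x = (\<lambda>m. T x + m) ` (T ` M')"
      unfolding coset_def image_image by (simp add: T.add)
    then show ?thesis by (simp add: TM coset_def)
  qed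
  have sM': "V'.subspace M'" using sub by (simp add: subalgebra_def)
  have "quotient_iso K' M' L (\<lambda>X. \<phi> (T ` X))"
  proof -
    have "bij_betw (\<lambda>X. T ` X) (coset M' ` carrier K') (coset M ` carrier K)"
      unfolding bij_betw_def
    proof
      show "inj_on ((`) T) (coset M' ` carrier K')"
      proof (rule inj_onI)
        fix X Y assume "X \<in> coset M' ` carrier K'" "Y \<in> coset M' ` carrier K'" and e: "T ` X = T ` Y"
        then obtain x y where xy: "x \<in> carrier K'" "y \<in> carrier K'" "X = coset M' x" "Y = coset M' y"
          by blast
        then have "coset M (T x) = coset M (T y)" using e Tc by simp
        then have "T x - T y \<in> M" using coset_eq_iff[OF K.vector_space M(3)] by blast
        then have "x - y \<in> M'" using xy V'.subspace_diff[OF S'] by (simp add: M'_def T.diff)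
        then show "X = Y" using xy coset_eq_iff[OF V' sM'] by blast
      qed
      show "(`) T ` coset M' ` carrier K' = coset M ` carrier K"
        unfolding image_image Tc im[symmetric] ..
    qed
    then have "bij_betw (\<lambda>X. \<phi> (T ` X)) (coset M' ` carrier K') (carrier L)"
      using \<phi> bij_betw_trans unfolding quotient_iso_def comp_def by blast
    then show ?thesis
      using \<phi> unfolding quotient_iso_def Tc by (simp add: cl T T.add T.scale)
  qed
  then have "defining_pair L K' M'"
    using K' sub cen der unfolding defining_pair_def by blast
  then show ?thesis using dim that by blast
qed

lemma dimension_le_card:
  assumes "vector_space (scalar K)" "finite W" "module.span (scalar K) W = carrier K"
  shows "dimension K \<le> card W"
proof -
  interpret vector_space "scalar K" by fact
  show ?thesis unfolding dimension_def using assms by (intro dim_le_card) auto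
qed

theorem maximal_defining_pair_universal:
  fixes L :: "('f::field, 'a::ab_group_add) dialgebra"
    and K\<^sub>1 :: "('f, 'b::ab_group_add) dialgebra"
  assumes "diassociative_algebra L" "finite_dimensional L"
    and max: "maximal_defining_pair L K M" and D: "defining_pair L K\<^sub>1 M\<^sub>1"
  shows "finite_dimensional K\<^sub>1" "dimension K\<^sub>1 \<le> dimension K"
proof -
  have VL: "vector_space (scalar L)" using assms(1) by (simp add: diassociative_algebra_def)
  obtain B where B: "finite B" "module.span (scalar L) B = carrier L"
    using assms(2) by (auto simp: finite_dimensional_def)
  show fin: "finite_dimensional K\<^sub>1"
    using defining_pair_spanning_set[OF D VL B] unfolding finite_dimensional_def by metis
  obtain K' :: "('f, nat \<Rightarrow> 'f) dialgebra" and M' where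
    "defining_pair L K' M'" "dimension K' = dimension K\<^sub>1"
    using defining_pair_transport[OF D fin] by blast
  then show "dimension K\<^sub>1 \<le> dimension K" using max unfolding maximal_defining_pair_def by metis
qed

theorem maximal_defining_pair_exists:
  fixes L :: "('f::field, 'a::ab_group_add) dialgebra"
  assumes "diassociative_algebra L" "finite_dimensional L"
  shows "\<exists>(K :: ('f, nat \<Rightarrow> 'f) dialgebra) M. maximal_defining_pair L K M"
proof -
  interpret L: diassociative_algebra L by fact
  interpret VL: vector_space "scalar L" by (rule L.vector_space)
  obtain B where B: "finite B" "module.span (scalar L) B = carrier L"
    using assms(2) by (auto simp: finite_dimensional_def)
  have z: "p 0 x = 0" "p x 0 = 0" if "bilinear_on (carrier L) (scalar L) p" "x \<in> carrier L" for p x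
  proof -
    have "p (scalar L 0 0) x = scalar L 0 (p 0 x)" "p x (scalar L 0 0) = scalar L 0 (p x 0)"
      using that VL.subspace_0[OF L.subspace] unfolding bilinear_on_def by blast+
    then show "p 0 x = 0" "p x 0 = 0" by simp_all
  qed
  note z = z[OF L.lprod_bilinear] z[OF L.rprod_bilinear]
  have 0: "0 \<in> carrier L" using VL.subspace_0[OF L.subspace] .
  have "defining_pair L L {0}"
    unfolding defining_pair_def
  proof (intro conjI)
    show "subalgebra {0} L" using 0 z by (simp add: subalgebra_def closed_under_def VL.subspace_def)
    show "{0} \<subseteq> center L \<inter> derived L"
      using 0 z VL.span_zero by (simp add: center_def derived_def lozenge_prod_def)
    have c: "coset {0} x = {x}" for x :: 'a by (simp add: coset_def)
    have "quotient_iso L {0} L the_elem"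
      unfolding quotient_iso_def c by (auto simp: bij_betw_def inj_on_def image_image)
    then show "\<exists>\<phi>. quotient_iso L {0} L \<phi>" by blast
  qed fact
  then obtain K\<^sub>0 :: "('f, nat \<Rightarrow> 'f) dialgebra" and M\<^sub>0 where K0: "defining_pair L K\<^sub>0 M\<^sub>0"
    using defining_pair_transport assms(2) by blast
  define N where "N = {dimension K | (K :: ('f, nat \<Rightarrow> 'f) dialgebra) M. defining_pair L K M}"
  have bnd: "dimension K \<le> card B + 2 * (card B * card B)"
    if D: "defining_pair L K M" for K :: "('f, nat \<Rightarrow> 'f) dialgebra" and M
  proof -
    obtain W where W: "finite W" "card W \<le> card B + 2 * (card B * card B)"
      "module.span (scalar K) W = carrier K"
      using defining_pair_spanning_set[OF D L.vector_space B] by blast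
    have "vector_space (scalar K)"
      using D by (simp add: defining_pair_def diassociative_algebra_def)
    then show ?thesis using dimension_le_card[of K W] W by linarith
  qed
  then have "finite N"
    unfolding N_def by (intro finite_subset[OF _ finite_atMost[of "card B + 2 * (card B * card B)"]]) auto
  moreover have "N \<noteq> {}" using K0 unfolding N_def by blast
  ultimately have "Max N \<in> N" "\<And>m. m \<in> N \<Longrightarrow> m \<le> Max N" by auto
  then show ?thesis unfolding maximal_defining_pair_def N_def by (smt (verit) mem_Collect_eq)
qed

end

theory Submission
  imports Defs
begin

text \<open>
  A defining pair \<open>(K, M)\<close> of \<open>L\<close> is the same thing as a surjective homomorphism \<open>K \<rightarrow> L\<close> whose
  kernel \<open>M\<close> is central and contained in \<open>K'\<close>; call it a stem extension.  Two facts make stem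
  extensions of perfect algebras rigid.

  First, they are perfect: the image of \<open>K'\<close> is \<open>L' = L\<close>, so \<open>K = K' + M = K'\<close>.  This gives
  \<open>C = C'\<close>.

  Secondly, their composites are again stem extensions.  Let \<open>C \<rightarrow> L\<close> have kernel \<open>M\<close> and
  \<open>K \<rightarrow> C\<close> have kernel \<open>N\<close>.  The kernel \<open>P\<close> of \<open>K \<rightarrow> L\<close> lies in \<open>K = K'\<close>; the question is whether
  it is central.  Products of \<open>P\<close> with \<open>K\<close> lie in \<open>N\<close>, hence in the center of \<open>K\<close>, so multiplying
  them once more by elements of \<open>K\<close> gives \<open>0\<close>; the diassociative identities turn this into
  the statement that \<open>P\<close> annihilates \<open>K' = K\<close> from both sides (\<open>central_if_products_central\<close>).

  Thus every stem extension \<open>K\<close> of a cover \<open>C\<close> of \<open>L\<close> is one of \<open>L\<close>, and maximality of \<open>C\<close> gives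
  \<open>dim K \<le> dim C\<close>.  Since \<open>K \<rightarrow> C\<close> is onto and everything is finite-dimensional, its kernel is \<open>0\<close>.
\<close>

section \<open>Defining pairs as surjective homomorphisms\<close>

text \<open>
  The isomorphism \<open>K/M \<rightarrow> L\<close> is replaced by the map that it induces on elements, because such maps
  compose directly, while quotients of quotients would need another isomorphism theorem.
\<close>

definition epi_with_kernel ::
  "('f::field, 'k::ab_group_add) dialgebra \<Rightarrow> 'k set \<Rightarrow> ('f, 'a::ab_group_add) dialgebra
    \<Rightarrow> ('k \<Rightarrow> 'a) \<Rightarrow> bool" where
  "epi_with_kernel K M L \<pi> \<longleftrightarrow>
     \<pi> ` carrier K = carrier L \<and>
     (\<forall>x\<in>carrier K. \<forall>y\<in>carrier K.
        \<pi> (x + y) = \<pi> x + \<pi> y \<and>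
        \<pi> (x \<stileturn>\<^bsub>K\<^esub> y) = \<pi> x \<stileturn>\<^bsub>L\<^esub> \<pi> y \<and>
        \<pi> (x \<turnstile>\<^bsub>K\<^esub> y) = \<pi> x \<turnstile>\<^bsub>L\<^esub> \<pi> y) \<and>
     (\<forall>a. \<forall>x\<in>carrier K. \<pi> (scalar K a x) = scalar L a (\<pi> x)) \<and>
     M = {x \<in> carrier K. \<pi> x = 0}"

lemma epi_with_kernelD:
  assumes "epi_with_kernel K M L \<pi>"
  shows "\<pi> ` carrier K = carrier L"
    and "\<And>x y. \<lbrakk>x \<in> carrier K; y \<in> carrier K\<rbrakk> \<Longrightarrow> \<pi> (x + y) = \<pi> x + \<pi> y"
    and "\<And>x y. \<lbrakk>x \<in> carrier K; y \<in> carrier K\<rbrakk> \<Longrightarrow> \<pi> (x \<stileturn>\<^bsub>K\<^esub> y) = \<pi> x \<stileturn>\<^bsub>L\<^esub> \<pi> y"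
    and "\<And>x y. \<lbrakk>x \<in> carrier K; y \<in> carrier K\<rbrakk> \<Longrightarrow> \<pi> (x \<turnstile>\<^bsub>K\<^esub> y) = \<pi> x \<turnstile>\<^bsub>L\<^esub> \<pi> y"
    and "\<And>a x. x \<in> carrier K \<Longrightarrow> \<pi> (scalar K a x) = scalar L a (\<pi> x)"
    and "M = {x \<in> carrier K. \<pi> x = 0}"
    and "\<And>x. x \<in> carrier K \<Longrightarrow> \<pi> x \<in> carrier L"
  using assms unfolding epi_with_kernel_def by blast+

lemma epi_with_kernel_linear:
  assumes K: "diassociative_algebra K" and e: "epi_with_kernel K M L \<pi>"
  shows "\<pi> 0 = 0"
    and "\<lbrakk>x \<in> carrier K; y \<in> carrier K\<rbrakk> \<Longrightarrow> \<pi> (x - y) = \<pi> x - \<pi> y"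
proof -
  interpret K: diassociative_algebra K by (rule K)
  interpret V: vector_space "scalar K" by (rule K.vector_space)
  note S = K.subspace
  have "\<pi> (0 + 0) = \<pi> 0 + \<pi> 0" using V.subspace_0[OF S] epi_with_kernelD(2)[OF e] by blast
  then show "\<pi> 0 = 0" by simp
  assume xy: "x \<in> carrier K" "y \<in> carrier K"
  then have "\<pi> ((x - y) + y) = \<pi> (x - y) + \<pi> y"
    using V.subspace_diff[OF S] epi_with_kernelD(2)[OF e] by blast
  then show "\<pi> (x - y) = \<pi> x - \<pi> y" by simp
qed

lemma epi_with_kernel_of_defining_pair:
  assumes D: "defining_pair L K M"
  obtains \<pi> where "epi_with_kernel K M L \<pi>"
proof -
  interpret K: diassociative_algebra K using D by (simp add: defining_pair_def)
  interpret V: vector_space "scalar K" by (rule K.vector_space)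
  note S = K.subspace
  have M: "V.subspace M" "M \<subseteq> carrier K" using D by (auto simp: defining_pair_def subalgebra_def)
  obtain \<phi> where \<phi>: "quotient_iso K M L \<phi>" using D by (auto simp: defining_pair_def)
  define \<pi> where "\<pi> x = \<phi> (coset M x)" for x
  have bij: "bij_betw \<phi> (coset M ` carrier K) (carrier L)" using \<phi> by (simp add: quotient_iso_def)
  have surj: "\<pi> ` carrier K = carrier L"
    using bij by (auto simp: \<pi>_def bij_betw_def image_image)
  have 0: "0 \<in> carrier K" using V.subspace_0[OF S] .
  have "\<pi> (0 + 0) = \<pi> 0 + \<pi> 0" using \<phi> 0 unfolding quotient_iso_def \<pi>_def by blast
  then have \<pi>0: "\<pi> 0 = 0" by simp
  have "x \<in> M \<longleftrightarrow> \<pi> x = 0" if x: "x \<in> carrier K" for x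
  proof -
    have "inj_on \<phi> (coset M ` carrier K)" using bij by (simp add: bij_betw_def)
    then have "\<pi> x = \<pi> 0 \<longleftrightarrow> coset M x = coset M 0"
      unfolding \<pi>_def by (rule inj_on_eq_iff) (use x 0 in simp_all)
    then show ?thesis using coset_eq_iff[OF K.vector_space M(1), of x 0] \<pi>0 by simp
  qed
  then have "M = {x \<in> carrier K. \<pi> x = 0}" using M(2) by blast
  then have "epi_with_kernel K M L \<pi>"
    unfolding epi_with_kernel_def using surj \<phi>[unfolded quotient_iso_def, folded \<pi>_def] by blast
  then show ?thesis by (rule that)
qed

lemma defining_pair_of_epi:
  assumes K: "diassociative_algebra K" and e: "epi_with_kernel K M L \<pi>"
    and M: "M \<subseteq> center K" "M \<subseteq> derived K"
  shows "defining_pair L K M"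
proof -
  interpret K: diassociative_algebra K by (rule K)
  interpret V: vector_space "scalar K" by (rule K.vector_space)
  note S = K.subspace
  note E = epi_with_kernelD[OF e] and lin = epi_with_kernel_linear[OF K e]
  have scale0: "scalar L a 0 = 0" for a
    using E(5)[of 0 a] lin(1) V.subspace_0[OF S] by simp
  have subM: "V.subspace M"
    unfolding V.subspace_def
    using V.subspace_0[OF S] V.subspace_add[OF S] V.subspace_scale[OF S] lin(1) E(2,5)
    by (auto simp: E(6) scale0)
  have sub: "subalgebra M K"
    using subM M(1) V.subspace_0[OF subM]
    by (auto simp: subalgebra_def closed_under_def center_def subset_iff)
  have eq: "coset M x = coset M y \<longleftrightarrow> \<pi> x = \<pi> y" if "x \<in> carrier K" "y \<in> carrier K" for x y
    using that coset_eq_iff[OF K.vector_space subM] V.subspace_diff[OF S] lin(2)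
    by (auto simp: E(6))
  \<comment> \<open>\<open>\<pi>\<close> is constant on cosets, so the induced map sends \<open>X\<close> to the element of \<open>\<pi> ` X\<close>\<close>
  have pick: "the_elem (\<pi> ` coset M x) = \<pi> x" if x: "x \<in> carrier K" for x
  proof -
    have "\<pi> ` coset M x = {\<pi> x}"
    proof
      show "\<pi> ` coset M x \<subseteq> {\<pi> x}" using x by (auto simp: coset_def E(2,6))
      have "x \<in> coset M x" using V.subspace_0[OF subM] unfolding coset_def by force
      then show "{\<pi> x} \<subseteq> \<pi> ` coset M x" by blast
    qed
    then show ?thesis by simp
  qed
  have cl: "x + y \<in> carrier K" "x \<stileturn>\<^bsub>K\<^esub> y \<in> carrier K" "x \<turnstile>\<^bsub>K\<^esub> y \<in> carrier K"
    "scalar K a x \<in> carrier K" if "x \<in> carrier K" "y \<in> carrier K" for x y a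
    using that V.subspace_add[OF S] V.subspace_scale[OF S] K.lprod_closed K.rprod_closed
    by (auto simp: closed_under_def)
  have "bij_betw (\<lambda>X. the_elem (\<pi> ` X)) (coset M ` carrier K) (carrier L)"
    unfolding bij_betw_def
  proof
    show "inj_on (\<lambda>X. the_elem (\<pi> ` X)) (coset M ` carrier K)"
      by (auto simp: inj_on_def pick eq)
    show "(\<lambda>X. the_elem (\<pi> ` X)) ` coset M ` carrier K = carrier L"
      by (simp add: image_image pick E(1))
  qed
  then have "quotient_iso K M L (\<lambda>X. the_elem (\<pi> ` X))"
    unfolding quotient_iso_def using E(2-5) by (simp add: pick cl)
  then show ?thesis using K sub M unfolding defining_pair_def by blast
qed


section \<open>Stem extensions of perfect algebras\<close>

lemma derived_subset_carrier:
  assumes "diassociative_algebra K"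
  shows "derived K \<subseteq> carrier K"
proof -
  interpret K: diassociative_algebra K by fact
  interpret V: vector_space "scalar K" by (rule K.vector_space)
  show ?thesis
    unfolding derived_def lozenge_prod_def using K.lprod_closed K.rprod_closed
    by (intro V.span_minimal K.subspace) (auto simp: closed_under_def)
qed

lemma lift_to_derived:
  assumes K: "diassociative_algebra K" and L: "diassociative_algebra L"
    and e: "epi_with_kernel K M L \<pi>" and y: "y \<in> derived L"
  shows "\<exists>u \<in> derived K. \<pi> u = y"
proof -
  interpret K: diassociative_algebra K by (rule K)
  interpret L: diassociative_algebra L by (rule L)
  interpret V: vector_space "scalar K" by (rule K.vector_space)
  interpret VL: vector_space "scalar L" by (rule L.vector_space)
  note E = epi_with_kernelD[OF e]
  note sub = derived_subset_carrier[OF K]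
  note dK = derived_def[of K, unfolded lozenge_prod_def]
  have sD: "V.subspace (derived K)" unfolding dK by (rule V.subspace_span)
  from y show ?thesis
    unfolding derived_def[of L] lozenge_prod_def
  proof (induction rule: VL.span_induct_alt)
    case base
    show ?case using V.subspace_0[OF sD] epi_with_kernel_linear(1)[OF K e] by blast
  next
    case (step c x y)
    then obtain s t where st: "s \<in> carrier L" "t \<in> carrier L" "x = s \<stileturn>\<^bsub>L\<^esub> t \<or> x = s \<turnstile>\<^bsub>L\<^esub> t"
      by blast
    obtain s' t' where st': "s' \<in> carrier K" "t' \<in> carrier K" "s = \<pi> s'" "t = \<pi> t'"
      using st E(1) by (metis imageE)
    have "s' \<stileturn>\<^bsub>K\<^esub> t' \<in> derived K" "s' \<turnstile>\<^bsub>K\<^esub> t' \<in> derived K"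
      unfolding dK by (rule V.span_base, use st' in blast)+
    then obtain v where v: "v \<in> derived K" "\<pi> v = x" using st(3) st' E(3,4) by metis
    obtain u where u: "u \<in> derived K" "\<pi> u = y" using step by blast
    have "\<pi> (scalar K c v + u) = scalar L c x + y"
      using u v sub V.subspace_scale[OF K.subspace] by (auto simp: E(2,5) subset_iff)
    then show ?case
      using V.subspace_add[OF sD V.subspace_scale[OF sD v(1)] u(1)] by blast
  qed
qed

lemma perfect_stem_extension:
  assumes K: "diassociative_algebra K" and L: "diassociative_algebra L" and "perfect L"
    and e: "epi_with_kernel K M L \<pi>" and M: "M \<subseteq> derived K"
  shows "perfect K"
proof -
  interpret K: diassociative_algebra K by (rule K)
  interpret V: vector_space "scalar K" by (rule K.vector_space)
  note E = epi_with_kernelD[OF e]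
  note sub = derived_subset_carrier[OF K]
  have sD: "V.subspace (derived K)"
    unfolding derived_def lozenge_prod_def by (rule V.subspace_span)
  have "x \<in> derived K" if x: "x \<in> carrier K" for x
  proof -
    have "\<pi> x \<in> derived L" using E(7)[OF x] \<open>perfect L\<close> by (simp add: perfect_def)
    then obtain u where u: "u \<in> derived K" "\<pi> u = \<pi> x" using lift_to_derived[OF K L e] by blast
    then have "x - u \<in> M"
      using x sub V.subspace_diff[OF K.subspace] epi_with_kernel_linear(2)[OF K e, of x u]
      by (auto simp: E(6))
    then show ?thesis using V.subspace_add[OF sD, of "x - u" u] u M by auto
  qed
  then show ?thesis using sub unfolding perfect_def by blast
qed

lemma perfect_vanishing:
  assumes K: "diassociative_algebra K" and "perfect K"
    and add: "\<And>x y. \<lbrakk>x \<in> carrier K; y \<in> carrier K\<rbrakk> \<Longrightarrow> f (x + y) = f x + f y"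
    and scale: "\<And>a x. x \<in> carrier K \<Longrightarrow> f (scalar K a x) = scalar K a (f x)"
    and prod: "\<And>x y. \<lbrakk>x \<in> carrier K; y \<in> carrier K\<rbrakk> \<Longrightarrow> f (x \<stileturn>\<^bsub>K\<^esub> y) = 0 \<and> f (x \<turnstile>\<^bsub>K\<^esub> y) = 0"
    and x: "x \<in> carrier K"
  shows "f x = (0 :: 'k::ab_group_add)"
proof -
  interpret K: diassociative_algebra K by (rule K)
  interpret V: vector_space "scalar K" by (rule K.vector_space)
  note S = K.subspace
  have "f (0 + 0) = f 0 + f 0" using V.subspace_0[OF S] add by blast
  then have "V.subspace {x \<in> carrier K. f x = 0}"
    using V.subspace_0[OF S] V.subspace_add[OF S] V.subspace_scale[OF S]
    unfolding V.subspace_def by (auto simp: add scale)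
  then have "derived K \<subseteq> {x \<in> carrier K. f x = 0}"
    unfolding derived_def lozenge_prod_def using K.lprod_closed K.rprod_closed prod
    by (intro V.span_minimal) (auto simp: closed_under_def)
  then show ?thesis using x \<open>perfect K\<close> unfolding perfect_def by blast
qed

text \<open>
  Multiplication by \<open>p\<close>, on a given side and with a given product, kills every product \<open>x y\<close>: an
  identity moves \<open>p\<close> next to one of the factors, and what results is the product of a central
  element with the other factor.  In \<open>p \<stileturn> (x \<turnstile> y)\<close> and \<open>(x \<stileturn> y) \<turnstile> p\<close> a bar identity first
  changes the product inside the parentheses, which makes associativity applicable.
\<close>

lemma central_if_products_central:
  assumes K: "diassociative_algebra K" and perf: "perfect K" and p: "p \<in> carrier K"
    and cen: "\<And>x. x \<in> carrier K \<Longrightarrow> p \<stileturn>\<^bsub>K\<^esub> x \<in> center K \<and> x \<stileturn>\<^bsub>K\<^esub> p \<in> center K \<and>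
      p \<turnstile>\<^bsub>K\<^esub> x \<in> center K \<and> x \<turnstile>\<^bsub>K\<^esub> p \<in> center K"
  shows "p \<in> center K"
proof -
  interpret K: diassociative_algebra K by (rule K)
  note bl = K.lprod_bilinear[unfolded bilinear_on_def] and br = K.rprod_bilinear[unfolded bilinear_on_def]
  have zero: "(p \<stileturn>\<^bsub>K\<^esub> x) \<stileturn>\<^bsub>K\<^esub> y = 0" "x \<stileturn>\<^bsub>K\<^esub> (y \<stileturn>\<^bsub>K\<^esub> p) = 0" "x \<turnstile>\<^bsub>K\<^esub> (y \<stileturn>\<^bsub>K\<^esub> p) = 0"
    "(p \<turnstile>\<^bsub>K\<^esub> x) \<turnstile>\<^bsub>K\<^esub> y = 0" "(p \<turnstile>\<^bsub>K\<^esub> x) \<stileturn>\<^bsub>K\<^esub> y = 0" "x \<turnstile>\<^bsub>K\<^esub> (y \<turnstile>\<^bsub>K\<^esub> p) = 0"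
    if "x \<in> carrier K" "y \<in> carrier K" for x y
    using cen that by (auto simp: center_def)
  have "p \<stileturn>\<^bsub>K\<^esub> x = 0" if "x \<in> carrier K" for x
  proof (rule perfect_vanishing[OF K perf, where f = "\<lambda>x. p \<stileturn>\<^bsub>K\<^esub> x"])
    fix x y assume "x \<in> carrier K" "y \<in> carrier K"
    then show "p \<stileturn>\<^bsub>K\<^esub> (x \<stileturn>\<^bsub>K\<^esub> y) = 0 \<and> p \<stileturn>\<^bsub>K\<^esub> (x \<turnstile>\<^bsub>K\<^esub> y) = 0"
      using K.left_bar[of p x y] K.lprod_assoc[of p x y] p zero(1) by simp
  qed (use bl p that in simp_all)
  moreover have "x \<stileturn>\<^bsub>K\<^esub> p = 0" if "x \<in> carrier K" for x
  proof (rule perfect_vanishing[OF K perf, where f = "\<lambda>x. x \<stileturn>\<^bsub>K\<^esub> p"])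
    fix x y assume "x \<in> carrier K" "y \<in> carrier K"
    then show "(x \<stileturn>\<^bsub>K\<^esub> y) \<stileturn>\<^bsub>K\<^esub> p = 0 \<and> (x \<turnstile>\<^bsub>K\<^esub> y) \<stileturn>\<^bsub>K\<^esub> p = 0"
      using K.inner_assoc[of x y p] K.lprod_assoc[of x y p] p zero(2,3) by simp
  qed (use bl p that in simp_all)
  moreover have "p \<turnstile>\<^bsub>K\<^esub> x = 0" if "x \<in> carrier K" for x
  proof (rule perfect_vanishing[OF K perf, where f = "\<lambda>x. p \<turnstile>\<^bsub>K\<^esub> x"])
    fix x y assume "x \<in> carrier K" "y \<in> carrier K"
    then show "p \<turnstile>\<^bsub>K\<^esub> (x \<stileturn>\<^bsub>K\<^esub> y) = 0 \<and> p \<turnstile>\<^bsub>K\<^esub> (x \<turnstile>\<^bsub>K\<^esub> y) = 0"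
      using K.inner_assoc[of p x y] K.rprod_assoc[of p x y] p zero(4,5) by simp
  qed (use br p that in simp_all)
  moreover have "x \<turnstile>\<^bsub>K\<^esub> p = 0" if "x \<in> carrier K" for x
  proof (rule perfect_vanishing[OF K perf, where f = "\<lambda>x. x \<turnstile>\<^bsub>K\<^esub> p"])
    fix x y assume "x \<in> carrier K" "y \<in> carrier K"
    then show "(x \<stileturn>\<^bsub>K\<^esub> y) \<turnstile>\<^bsub>K\<^esub> p = 0 \<and> (x \<turnstile>\<^bsub>K\<^esub> y) \<turnstile>\<^bsub>K\<^esub> p = 0"
      using K.right_bar[of x y p] K.rprod_assoc[of x y p] p zero(6) by simp
  qed (use br p that in simp_all)
  ultimately show ?thesis using p by (simp add: center_def)
qed

lemma epi_with_kernel_comp: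
  assumes K: "epi_with_kernel K N C \<rho>" and C: "epi_with_kernel C M L \<pi>"
  shows "epi_with_kernel K {x \<in> carrier K. \<rho> x \<in> M} L (\<pi> \<circ> \<rho>)"
proof -
  note EK = epi_with_kernelD[OF K] and EC = epi_with_kernelD[OF C]
  have "(\<pi> \<circ> \<rho>) ` carrier K = carrier L" by (simp only: image_comp[symmetric] EK(1) EC(1))
  then show ?thesis
    unfolding epi_with_kernel_def using EK(2-5,7) EC(2-5) by (auto simp: EC(6))
qed

lemma defining_pair_comp:
  assumes L: "diassociative_algebra L" "perfect L"
    and DC: "defining_pair L C M" and DK: "defining_pair C K N"
  shows "\<exists>P. defining_pair L K P"
proof -
  have C: "diassociative_algebra C" and K: "diassociative_algebra K"
    and M: "M \<subseteq> center C" "M \<subseteq> derived C" and N: "N \<subseteq> center K" "N \<subseteq> derived K"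
    using DC DK by (auto simp: defining_pair_def)
  interpret K: diassociative_algebra K by (rule K)
  obtain \<pi> where \<pi>: "epi_with_kernel C M L \<pi>" by (rule epi_with_kernel_of_defining_pair[OF DC])
  obtain \<rho> where \<rho>: "epi_with_kernel K N C \<rho>" by (rule epi_with_kernel_of_defining_pair[OF DK])
  note E = epi_with_kernelD[OF \<rho>]
  have "perfect C" by (rule perfect_stem_extension[OF C L \<pi> M(2)])
  then have perf: "perfect K" by (rule perfect_stem_extension[OF K C _ \<rho> N(2)])
  let ?P = "{x \<in> carrier K. \<rho> x \<in> M}"
  have "?P \<subseteq> center K"
  proof
    fix p assume p: "p \<in> ?P"
    \<comment> \<open>since \<open>\<rho> p\<close> is central in \<open>C\<close>, the products of \<open>p\<close> with \<open>K\<close> lie in the kernel of \<open>\<rho>\<close>\<close>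
    have "p \<stileturn>\<^bsub>K\<^esub> x \<in> N \<and> x \<stileturn>\<^bsub>K\<^esub> p \<in> N \<and> p \<turnstile>\<^bsub>K\<^esub> x \<in> N \<and> x \<turnstile>\<^bsub>K\<^esub> p \<in> N"
      if x: "x \<in> carrier K" for x
    proof -
      have "\<rho> p \<in> center C" using p M by auto
      then show ?thesis using p x E(7)[OF x] K.lprod_closed K.rprod_closed
        by (auto simp: E(3,4,6) center_def closed_under_def)
    qed
    then show "p \<in> center K" using p N(1) by (intro central_if_products_central[OF K perf]) blast+
  qed
  moreover have "?P \<subseteq> derived K" using perf unfolding perfect_def by blast
  ultimately show ?thesis
    using defining_pair_of_epi[OF K epi_with_kernel_comp[OF \<rho> \<pi>]] by blast
qed


section \<open>Dimension and the cover\<close>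

text \<open>
  A nonzero element of the kernel extends to a basis of \<open>K\<close>, and the images of the remaining basis
  vectors already span \<open>C\<close>.
\<close>

lemma trivial_kernel_if_dimension_le:
  assumes K: "diassociative_algebra K" and C: "diassociative_algebra C"
    and e: "epi_with_kernel K N C \<rho>"
    and fin: "finite_dimensional K" and le: "dimension K \<le> dimension C"
  shows "N = {0}"
proof -
  interpret K: diassociative_algebra K by (rule K)
  interpret C: diassociative_algebra C by (rule C)
  interpret V: vector_space "scalar K" by (rule K.vector_space)
  interpret VC: vector_space "scalar C" by (rule C.vector_space)
  note E = epi_with_kernelD[OF e] and S = K.subspace
  note \<rho>0 = epi_with_kernel_linear(1)[OF K e]
  have "n = 0" if n: "n \<in> N" for n
  proof (rule ccontr)
    assume "n \<noteq> 0"
    then have "V.independent {n}" by simp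
    moreover have nK: "n \<in> carrier K" "\<rho> n = 0" using n by (auto simp: E(6))
    ultimately obtain B where B: "{n} \<subseteq> B" "B \<subseteq> carrier K" "V.independent B" "carrier K \<subseteq> V.span B"
      using V.maximal_independent_subset_extend[of "{n}" "carrier K"] by auto
    have span: "V.span B = carrier K" using B S V.span_minimal by blast
    obtain W where W: "finite W" "V.span W = carrier K"
      using fin by (auto simp: finite_dimensional_def)
    have finB: "finite B" using V.independent_span_bound[OF W(1) B(3)] B(2) W(2) by blast
    have dimK: "dimension K = card B"
      unfolding dimension_def using V.dim_unique[OF B(2,4,3)] by simp
    have img: "x \<in> carrier K \<and> \<rho> x \<in> VC.span (\<rho> ` (B - {n}))" if "x \<in> V.span B" for x
      using that
    proof (induction rule: V.span_induct_alt)
      case base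
      then show ?case using \<rho>0 VC.span_zero V.subspace_0[OF S] by simp
    next
      case (step c x y)
      have x: "x \<in> carrier K" "scalar K c x \<in> carrier K"
        using step B(2) V.subspace_scale[OF S] by auto
      have "\<rho> x \<in> VC.span (\<rho> ` (B - {n}))"
      proof (cases "x = n")
        case True
        then show ?thesis using nK VC.span_zero by simp
      next
        case False
        then show ?thesis using step by (intro VC.span_base) auto
      qed
      then show ?case
        using x step V.subspace_add[OF S] by (simp add: E(2,5) VC.span_add VC.span_scale)
    qed
    have "carrier C \<subseteq> VC.span (\<rho> ` (B - {n}))" using img by (auto simp: E(1)[symmetric] span)
    then have "dimension C \<le> card (\<rho> ` (B - {n}))"
      unfolding dimension_def using finB by (intro VC.dim_le_card) auto
    also have "\<dots> \<le> card (B - {n})" using finB by (intro card_image_le) auto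
    also have "\<dots> < card B" using finB B(1) by (intro card_Diff1_less) auto
    finally show False using le dimK by simp
  qed
  moreover have "0 \<in> N" using \<rho>0 V.subspace_0[OF S] by (simp add: E(6))
  ultimately show ?thesis by blast
qed

theorem theorem3p7:
  fixes L :: "('f::field, 'a::ab_group_add) dialgebra"
    and C :: "('f, 'c::ab_group_add) dialgebra"
  assumes "diassociative_algebra L"
    and "finite_dimensional L"
    and "perfect L"
    and "is_cover L C"
  shows "carrier C = derived C \<and> (\<forall>M :: 'k::ab_group_add set. is_multiplier C M \<longrightarrow> M = {0})"
proof -
  obtain M where max: "maximal_defining_pair L C M"
    using assms(4) by (auto simp: is_cover_def)
  then have D: "defining_pair L C M" by (simp add: maximal_defining_pair_def)
  then have C: "diassociative_algebra C" and M: "M \<subseteq> derived C" by (auto simp: defining_pair_def)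
  obtain \<pi> where \<pi>: "epi_with_kernel C M L \<pi>" by (rule epi_with_kernel_of_defining_pair[OF D])
  have "perfect C" by (rule perfect_stem_extension[OF C assms(1,3) \<pi> M])
  moreover have "N = {0}" if mult: "is_multiplier C N" for N :: "'k set"
  proof -
    obtain K :: "('f, 'k) dialgebra" where DK: "defining_pair C K N"
      using mult by (auto simp: is_multiplier_def maximal_defining_pair_def)
    then have K: "diassociative_algebra K" by (simp add: defining_pair_def)
    obtain P where P: "defining_pair L K P"
      using defining_pair_comp[OF assms(1,3) D DK] by blast
    obtain \<rho> where \<rho>: "epi_with_kernel K N C \<rho>" by (rule epi_with_kernel_of_defining_pair[OF DK])
    show ?thesis
      using trivial_kernel_if_dimension_le[OF K C \<rho>]
        maximal_defining_pair_universal[OF assms(1,2) max P] by blast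
  qed
  ultimately show ?thesis unfolding perfect_def by blast
qed

end
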